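(* Let $p\in[1,2)$, let $P$ be the $(p-1)$-homogeneous operator on $\mathbb{R}^M$ described in the context, and let $f\in\mathbb{R}^M$, $f\neq0$, be an eigenfunction of $P$, i.e. $P(f)=\lambda f$. Let the solution $\psi(t)=a(t)f$ of $\psi_t=P(\psi)$, $\psi(0)=f$, be sampled with a fixed step size $dt>0$, $\psi_k=a_kf$ with $a_k=a(k\,dt)$, $k=0,\dots,N$ (so $a_0=1$), and write $\bm{a}_k^m=[a_k\ \cdots\ a_m]^T$. Then classical DMD applied to $\{\psi_k\}_{k=0}^N$ has for $r=1$ the analytic solution $$\mu=\frac{\langle \bm{a}_1^N,\bm{a}_0^{N-1}\rangle}{\|\bm{a}_0^{N-1}\|^2},\qquad \phi=\frac{f}{\|f\|},\qquad \alpha=\|f\|,$$ and the DMD error is $$ERR_{DMD}=\|\bm{a}_1^{N}\|^2-\frac{\langle \bm{a}_1^N,\bm{a}_0^{N-1}\rangle^2}{\|\bm{a}_0^{N-1}\|^2}.$$ For $r>1$ the solution does not exist.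
   Context: Setting. $\mathbb{R}^M$ carries the Euclidean inner product and norm. $R:\mathbb{R}^M\to\mathbb{R}^+$ is absolutely $p$-homogeneous, $R(c\psi)=|c|^pR(\psi)$ for $c\in\mathbb{R}$, and $P=-\partial_\psi R$ is $(p-1)$-homogeneous, $P(c\psi)=c|c|^{p-2}P(\psi)$; $-P$ is assumed maximally monotone, so eigenvalues satisfy $\lambda\le0$. It is known that if $P(f)=\lambda f$ then the solution of $\psi_t=P(\psi)$, $\psi(0)=f$, is $\psi(t)=a(t)f$ with $a(t)=\left[(1+(2-p)\lambda t)^+\right]^{\frac{1}{2-p}}$, where $(x)^+=\max\{0,x\}$. DMD (Dynamic Mode Decomposition) of dimensionality $r$ for data $\psi_0,\dots,\psi_N\in\mathbb{R}^M$. Put $\Psi_0^{N-1}=[\psi_0\ \cdots\ \psi_{N-1}]$, $\Psi_1^N=[\psi_1\ \cdots\ \psi_N]$. Take a singular value decomposition $\Psi_0^{N-1}=U\Sigma V^*$ with the dominant singular values first, and let $U_r$ be the first $r$ columns of $U$. Set $X=U_r^*\Psi_0^{N-1}$, $Y=U_r^*\Psi_1^N$. The DMD matrix $F$ is the minimizer in $$ERR_{DMD}=\min_F\|Y-FX\|_{\mathcal F}^2\quad(\text{Frobenius norm}),$$ given by $F=YX^T(XX^T)^{-1}$; the DMD solution is said not to exist when $XX^T$ is not invertible. Let $\mu_i$, $w_i$ ($i=1,\dots,r$) be the eigenvalues and (normalized) right eigenvectors of $F$; the modes are $\phi_i=U_rw_i$ and the coordinates are $\alpha_i=w_i^*U_r^*\psi_0$.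 For $r=1$ the subscript is dropped.
   Formalization: The DMD error is proved with a factor ‖f‖² in front of the printed expression, which is false for ‖f‖≠1 unless it vanishes; φ and α are as stated for a suitable normalized eigenvector and up to a unit phase for any other. *)

theory Defs
  imports
    Complex_Main
    "Jordan_Normal_Form.Gauss_Jordan_Elimination"
    "Jordan_Normal_Form.Char_Poly"
    "Jordan_Normal_Form.Conjugate"
begin

section \<open>Homogeneous gradient flows on \<open>\<real>\<^sup>M\<close>\<close>

text \<open>
  The space \<open>\<real>\<^sup>M\<close> is \<^term>\<open>carrier_vec M :: real vec set\<close>. Operators are set-valued, since for
  \<open>p = 1\<close> a non-constant \<open>R\<close> is not differentiable at the origin and a maximally monotone \<open>-P\<close>
  has to be multivalued there. An equation \<open>P f = u\<close> is accordingly read as \<open>u \<in> P f\<close>.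
\<close>

definition vnorm :: "real vec \<Rightarrow> real" where
  "vnorm v = sqrt (v \<bullet> v)"

definition subdifferential :: "nat \<Rightarrow> (real vec \<Rightarrow> real) \<Rightarrow> real vec \<Rightarrow> real vec set" where
  "subdifferential M R x =
     {g \<in> carrier_vec M. \<forall>y\<in>carrier_vec M. R x + g \<bullet> (y - x) \<le> R y}"

definition monotone_op :: "nat \<Rightarrow> (real vec \<Rightarrow> real vec set) \<Rightarrow> bool" where
  "monotone_op M A \<longleftrightarrow>
     (\<forall>x\<in>carrier_vec M. \<forall>y\<in>carrier_vec M. A x \<subseteq> carrier_vec M \<and>
        (\<forall>u\<in>A x. \<forall>v\<in>A y. 0 \<le> (u - v) \<bullet> (x - y)))"

definition maximal_monotone_op :: "nat \<Rightarrow> (real vec \<Rightarrow> real vec set) \<Rightarrow> bool" where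
  "maximal_monotone_op M A \<longleftrightarrow> monotone_op M A \<and>
     (\<forall>B. monotone_op M B \<and> (\<forall>x\<in>carrier_vec M. A x \<subseteq> B x) \<longrightarrow>
        (\<forall>x\<in>carrier_vec M. B x = A x))"

definition abs_homogeneous :: "nat \<Rightarrow> real \<Rightarrow> (real vec \<Rightarrow> real) \<Rightarrow> bool" where
  "abs_homogeneous M p R \<longleftrightarrow>
     (\<forall>c. \<forall>x\<in>carrier_vec M. R (c \<cdot>\<^sub>v x) = \<bar>c\<bar> powr p * R x)"

text \<open>The factor \<open>c|c|\<^bsup>p-2\<^esup>\<close> is meaningful only for \<open>c \<noteq> 0\<close> as \<open>p < 2\<close>.\<close>

definition homogeneous_op :: "nat \<Rightarrow> real \<Rightarrow> (real vec \<Rightarrow> real vec set) \<Rightarrow> bool" where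
  "homogeneous_op M p P \<longleftrightarrow>
     (\<forall>c. c \<noteq> 0 \<longrightarrow> (\<forall>x\<in>carrier_vec M.
        P (c \<cdot>\<^sub>v x) = (\<lambda>u. (c * \<bar>c\<bar> powr (p - 2)) \<cdot>\<^sub>v u) ` P x))"

definition gradient_flow_setting ::
    "nat \<Rightarrow> real \<Rightarrow> (real vec \<Rightarrow> real) \<Rightarrow> (real vec \<Rightarrow> real vec set) \<Rightarrow> bool" where
  "gradient_flow_setting M p R P \<longleftrightarrow>
     (\<forall>x\<in>carrier_vec M. 0 \<le> R x) \<and>
     abs_homogeneous M p R \<and>
     (\<forall>x\<in>carrier_vec M. P x = uminus ` subdifferential M R x) \<and>
     homogeneous_op M p P \<and>
     maximal_monotone_op M (\<lambda>x. uminus ` P x)"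

text \<open>
  Strong solutions: for \<open>p = 1\<close> the trajectory has a kink at its extinction time, so the
  derivative is one-sided.
\<close>

definition flow_solution ::
    "nat \<Rightarrow> (real vec \<Rightarrow> real vec set) \<Rightarrow> real vec \<Rightarrow> (real \<Rightarrow> real vec) \<Rightarrow> bool" where
  "flow_solution M P f \<psi> \<longleftrightarrow>
     (\<forall>t\<ge>0. \<psi> t \<in> carrier_vec M) \<and> \<psi> 0 = f \<and>
     (\<forall>i<M. continuous_on {0..} (\<lambda>t. \<psi> t $ i)) \<and>
     (\<forall>t\<ge>0. \<exists>v\<in>P (\<psi> t). \<forall>i<M. ((\<lambda>s. \<psi> s $ i) has_real_derivative v $ i) (at_right t))"

definition decay :: "real \<Rightarrow> real \<Rightarrow> real \<Rightarrow> real" where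
  "decay p lam t = (max 0 (1 + (2 - p) * lam * t)) powr (1 / (2 - p))"

section \<open>Dynamic mode decomposition\<close>

text \<open>\<open>seq_vec a k m\<close> is \<open>[a\<^sub>k \<dots> a\<^sub>m]\<^sup>T\<close> and \<open>snapshot_mat M \<psi> k m\<close> is \<open>[\<psi>\<^sub>k \<dots> \<psi>\<^sub>m]\<close>.\<close>

definition seq_vec :: "(nat \<Rightarrow> real) \<Rightarrow> nat \<Rightarrow> nat \<Rightarrow> real vec" where
  "seq_vec a k m = vec_of_list (map a [k..<Suc m])"

definition snapshot_mat :: "nat \<Rightarrow> (nat \<Rightarrow> real vec) \<Rightarrow> nat \<Rightarrow> nat \<Rightarrow> real mat" where
  "snapshot_mat M \<psi> k m = mat_of_cols M (map \<psi> [k..<Suc m])"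

text \<open>Full singular value decomposition \<open>A = U S V\<^sup>T\<close>, singular values in decreasing order.\<close>

definition is_svd :: "real mat \<Rightarrow> real mat \<Rightarrow> real mat \<Rightarrow> real mat \<Rightarrow> bool" where
  "is_svd A U S V \<longleftrightarrow>
     U \<in> carrier_mat (dim_row A) (dim_row A) \<and> U\<^sup>T * U = 1\<^sub>m (dim_row A) \<and>
     V \<in> carrier_mat (dim_col A) (dim_col A) \<and> V\<^sup>T * V = 1\<^sub>m (dim_col A) \<and>
     S \<in> carrier_mat (dim_row A) (dim_col A) \<and> diagonal_mat S \<and>
     (\<forall>i < min (dim_row A) (dim_col A). 0 \<le> S $$ (i, i)) \<and>
     (\<forall>i j. i \<le> j \<and> j < min (dim_row A) (dim_col A) \<longrightarrow> S $$ (j, j) \<le> S $$ (i, i)) \<and>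
     A = U * S * V\<^sup>T"

definition first_cols :: "nat \<Rightarrow> 'a mat \<Rightarrow> 'a mat" where
  "first_cols r U = mat (dim_row U) r (\<lambda>(i, j). U $$ (i, j))"

definition dmd_project :: "nat \<Rightarrow> real mat \<Rightarrow> real mat \<Rightarrow> real mat" where
  "dmd_project r U \<Psi> = (first_cols r U)\<^sup>T * \<Psi>"

definition frobenius_sq :: "real mat \<Rightarrow> real" where
  "frobenius_sq A = (\<Sum>i<dim_row A. \<Sum>j<dim_col A. (A $$ (i, j))\<^sup>2)"

definition dmd_exists :: "real mat \<Rightarrow> bool" where
  "dmd_exists X \<longleftrightarrow> invertible_mat (X * X\<^sup>T)"

definition dmd_matrix :: "real mat \<Rightarrow> real mat \<Rightarrow> real mat" where
  "dmd_matrix X Y = Y * X\<^sup>T * the (mat_inverse (X * X\<^sup>T))"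

definition dmd_err :: "real mat \<Rightarrow> real mat \<Rightarrow> real" where
  "dmd_err X Y = (INF F \<in> carrier_mat (dim_row X) (dim_row X). frobenius_sq (Y - F * X))"

text \<open>
  Eigenpairs are complex: the matrix \<open>F\<close> is real but in general not symmetric. The coordinate
  below is \<open>w\<^sup>* U\<^sub>r\<^sup>* \<psi>\<^sub>0\<close>, as the second argument of the product is the conjugated one.
\<close>

definition dmd_eigenpair :: "real mat \<Rightarrow> complex \<Rightarrow> complex vec \<Rightarrow> bool" where
  "dmd_eigenpair F \<mu> w \<longleftrightarrow> eigenvector (map_mat complex_of_real F) w \<mu> \<and> w \<bullet>c w = 1"

definition dmd_mode :: "nat \<Rightarrow> real mat \<Rightarrow> complex vec \<Rightarrow> complex vec" where
  "dmd_mode r U w = map_mat complex_of_real (first_cols r U) *\<^sub>v w"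

definition dmd_coord :: "nat \<Rightarrow> real mat \<Rightarrow> real vec \<Rightarrow> complex vec \<Rightarrow> complex" where
  "dmd_coord r U \<psi>\<^sub>0 w = map_vec complex_of_real ((first_cols r U)\<^sup>T *\<^sub>v \<psi>\<^sub>0) \<bullet>c w"

end

(* Monotonicity of -P makes the squared distance of two solutions non-increasing, so the given
   trajectory is a(t) f and the snapshot matrices are the rank-one products f a^T. In any singular
   value decomposition of f a^T the rows of U^T f a^T are multiples of a and pairwise orthogonal, so at
   most one of them is nonzero, and the ordering of the singular values forces it to be the first.
   Hence U_1 = f / |f| up to a sign, the projected data has a single nonzero row, and for one mode
   everything is a scalar least squares problem. *)
theory Submission
  imports Defs
begin

section \<open>Preliminaries: a one-sided monotonicity criterion and the inner product\<close>

text \<open>Only right derivatives are at hand, so the mean value theorem does not apply.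
  Subtracting a small slope makes them strictly negative, and the last time at which the tilted
  bound holds must then be \<open>b\<close>.\<close>

lemma right_derivative_nonpos_imp_le:
  fixes g :: "real \<Rightarrow> real"
  assumes cont: "continuous_on {a..b} g" and ab: "a \<le> b"
    and der: "\<And>t. a \<le> t \<Longrightarrow> t < b \<Longrightarrow> \<exists>d\<le>0. (g has_real_derivative d) (at_right t)"
  shows "g b \<le> g a"
proof (rule field_le_epsilon)
  fix e :: real assume "e > 0"
  \<comment> \<open>The total tilt \<open>c * (b - a)\<close> stays below \<open>e\<close>; the
    summand 1 keeps the denominator positive when \<open>a = b\<close>.\<close>
  define c where "c = e / (1 + (b - a))"
  have c: "c > 0" "c * (b - a) \<le> e"
    using \<open>e > 0\<close> ab by (auto simp: c_def field_simps)
  define h where "h = (\<lambda>t. g t - c * (t - a))"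
  define S where "S = {s \<in> {a..b}. h s \<le> g a}"
  have hcont: "continuous_on {a..b} h"
    unfolding h_def by (intro continuous_intros cont)
  have "closed S"
    using hcont unfolding S_def continuous_on_closed_vimage[OF closed_atLeastAtMost]
    by (auto dest!: spec[of _ "{..g a}"] simp: vimage_def Int_def conj_commute)
  moreover have "S = {a..b} \<inter> S" by (auto simp: S_def)
  ultimately have "compact S" by (metis compact_Icc compact_Int_closed)
  moreover have "S \<noteq> {}" using ab by (auto simp: S_def h_def)
  ultimately obtain s where s: "s \<in> S" and max: "\<And>t. t \<in> S \<Longrightarrow> t \<le> s"
    by (metis compact_attains_sup)
  have "s = b"
  proof (rule ccontr)
    assume "s \<noteq> b"
    with s have lt: "a \<le> s" "s < b" by (auto simp: S_def)
    from der[OF lt] obtain d where d: "d \<le> 0" "(g has_real_derivative d) (at_right s)" by blast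
    have "(h has_real_derivative (d - c)) (at_right s)"
      unfolding h_def by (rule derivative_eq_intros d refl | simp)+
    from has_real_derivative_neg_dec_right[OF this] d c obtain \<delta> where
      \<delta>: "\<delta> > 0" "\<And>k. 0 < k \<Longrightarrow> k < \<delta> \<Longrightarrow> h (s + k) < h (s)" by auto
    \<comment> \<open>A step short enough for \<open>h\<close> to have decreased and for
      \<open>s + k\<close> to stay in the interval; it contradicts the maximality of
      \<open>s\<close>.\<close>
    define k where "k = min (\<delta> / 2) (b - s)"
    have k: "0 < k" "k < \<delta>" "s + k \<le> b" using \<delta>(1) lt by (auto simp: k_def)
    with \<delta>(2)[of k] s have "s + k \<in> S" by (auto simp: S_def)
    from max[OF this] k show False by simp
  qed
  with s have "h b \<le> g a" by (simp add: S_def)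
  with c show "g b \<le> g a + e" by (simp add: h_def)
qed

lemma scalar_prod_lessThan:
  assumes "v \<in> carrier_vec n" "w \<in> carrier_vec n"
  shows "v \<bullet> w = (\<Sum>i<n. v $ i * w $ i)"
  using assms by (simp add: scalar_prod_def lessThan_atLeast0)

lemma vnorm_power2: "(vnorm v)\<^sup>2 = v \<bullet> v"
  by (simp add: vnorm_def scalar_prod_def sum_nonneg)

lemma scalar_prod_self_pos:
  fixes v :: "real vec"
  assumes "v \<in> carrier_vec n" "v \<noteq> 0\<^sub>v n"
  shows "0 < v \<bullet> v"
proof -
  obtain i where i: "i < n" "v $ i \<noteq> 0"
    using assms by (metis carrier_vecD eq_vecI index_zero_vec)
  have "0 < (\<Sum>i<n. v $ i * v $ i)"
    by (rule sum_pos2[of _ i]) (use i in \<open>auto simp: zero_less_mult_iff\<close>)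
  with assms show ?thesis by (simp add: scalar_prod_lessThan)
qed

section \<open>The gradient flow started at an eigenfunction\<close>

text \<open>Two solutions start at distance zero. The right derivative of their squared distance is
  twice the inner product of the difference of positions with the difference of velocities, which
  monotonicity of \<open>-P\<close> makes nonpositive.\<close>

lemma flow_solution_unique:
  assumes mono: "monotone_op M (\<lambda>x. uminus ` P x)"
    and \<psi>: "flow_solution M P f \<psi>" and \<phi>: "flow_solution M P f \<phi>" and t: "t \<ge> 0"
  shows "\<psi> t = \<phi> t"
proof -
  define g where "g = (\<lambda>t. \<Sum>i<M. (\<psi> t $ i - \<phi> t $ i)\<^sup>2)"
  have car: "\<psi> s \<in> carrier_vec M" "\<phi> s \<in> carrier_vec M" if "s \<ge> 0" for s
    using \<psi> \<phi> that by (auto simp: flow_solution_def)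
  have cont: "continuous_on {0..t} (\<lambda>t. \<psi> t $ i)" "continuous_on {0..t} (\<lambda>t. \<phi> t $ i)"
    if "i < M" for i
    using \<psi> \<phi> that unfolding flow_solution_def
    by (meson atLeast_iff atLeastAtMost_iff continuous_on_subset subsetI)+
  have "g t \<le> g 0"
  proof (rule right_derivative_nonpos_imp_le[OF _ t])
    show "continuous_on {0..t} g"
      unfolding g_def by (intro continuous_intros cont) auto
    fix s :: real assume s: "0 \<le> s"
    from \<psi> s obtain v where v: "v \<in> P (\<psi> s)"
      "\<And>i. i < M \<Longrightarrow> ((\<lambda>s. \<psi> s $ i) has_real_derivative v $ i) (at_right s)"
      unfolding flow_solution_def by blast
    from \<phi> s obtain w where w: "w \<in> P (\<phi> s)"
      "\<And>i. i < M \<Longrightarrow> ((\<lambda>s. \<phi> s $ i) has_real_derivative w $ i) (at_right s)"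
      unfolding flow_solution_def by blast
    have sub: "uminus ` P x \<subseteq> carrier_vec M" if "x \<in> carrier_vec M" for x
      using mono that unfolding monotone_op_def by blast
    have vw: "v \<in> carrier_vec M" "w \<in> carrier_vec M"
      using subsetD[OF sub[OF car(1)[OF s]] imageI[OF v(1)]]
        subsetD[OF sub[OF car(2)[OF s]] imageI[OF w(1)]] by simp_all
    have "0 \<le> (- v - - w) \<bullet> (\<psi> s - \<phi> s)"
      using mono car[OF s] v(1) w(1) unfolding monotone_op_def by blast
    also have "\<dots> = (\<Sum>i<M. (- v - - w) $ i * (\<psi> s - \<phi> s) $ i)"
      using vw car[OF s] by (intro scalar_prod_lessThan) auto
    also have "\<dots> = (\<Sum>i<M. (w $ i - v $ i) * (\<psi> s $ i - \<phi> s $ i))"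
      using vw car[OF s] by (intro sum.cong) auto
    finally have "0 \<le> (\<Sum>i<M. (w $ i - v $ i) * (\<psi> s $ i - \<phi> s $ i))" .
    moreover have "(\<Sum>i<M. 2 * (\<psi> s $ i - \<phi> s $ i) * (v $ i - w $ i)) =
        - 2 * (\<Sum>i<M. (w $ i - v $ i) * (\<psi> s $ i - \<phi> s $ i))"
      unfolding sum_distrib_left by (intro sum.cong refl) (simp add: algebra_simps)
    ultimately have "(\<Sum>i<M. 2 * (\<psi> s $ i - \<phi> s $ i) * (v $ i - w $ i)) \<le> 0" by linarith
    moreover have "(g has_real_derivative (\<Sum>i<M. 2 * (\<psi> s $ i - \<phi> s $ i) * (v $ i - w $ i))) (at_right s)"
      unfolding g_def
    proof (rule DERIV_sum)
      fix i assume "i \<in> {..<M}"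
      then have "i < M" by simp
      from DERIV_power[OF DERIV_diff[OF v(2)[OF this] w(2)[OF this]], of 2]
      show "((\<lambda>t. (\<psi> t $ i - \<phi> t $ i)\<^sup>2) has_real_derivative
          2 * (\<psi> s $ i - \<phi> s $ i) * (v $ i - w $ i)) (at_right s)"
        by (rule DERIV_cong) (simp add: algebra_simps)
    qed
    ultimately show "\<exists>d\<le>0. (g has_real_derivative d) (at_right s)" by blast
  qed
  also have "g 0 = 0" using \<psi> \<phi> by (simp add: g_def flow_solution_def)
  finally have "g t \<le> 0" .
  moreover have "g t \<ge> 0" by (simp add: g_def sum_nonneg)
  ultimately have "g t = 0" by linarith
  then have "\<forall>i<M. \<psi> t $ i = \<phi> t $ i"
    unfolding g_def by (subst (asm) sum_nonneg_eq_0_iff) auto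
  with car[OF t] show ?thesis by (intro eq_vecI) auto
qed

text \<open>Before extinction this is the chain rule; from extinction on, the function is constantly
  zero because its base does not increase. For \<open>p = 1\<close> and \<open>lam < 0\<close> the
  two one-sided derivatives differ at the extinction time.\<close>

lemma decay_has_right_derivative:
  assumes p: "p < 2" and lam: "lam \<le> 0" and t: "t \<ge> 0"
  shows "(decay p lam has_real_derivative
    (if 1 + (2 - p) * lam * t > 0 then lam * decay p lam t powr (p - 1) else 0)) (at_right t)"
proof (cases "1 + (2 - p) * lam * t > 0")
  case True
  define b where "b = (\<lambda>s. 1 + (2 - p) * lam * s)"
  define q where "q = 1 / (2 - p)"
  have q: "q * (2 - p) = 1" using p by (simp add: q_def)
  have "isCont b t" unfolding b_def by (intro continuous_intros)
  moreover have bt: "b t > 0" using True by (simp add: b_def)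
  \<comment> \<open>Near \<open>t\<close> the cut-off \<open>max 0\<close> is inactive, so
    \<open>decay\<close> agrees locally with a plain power of \<open>b\<close>.\<close>
  ultimately have ev: "\<forall>\<^sub>F s in nhds t. b s > 0"
    by (metis (mono_tags) isCont_def eventually_nhds_conv_at order_tendstoD(1))
  \<comment> \<open>This turns the exponent produced by differentiation into the power
    \<open>p - 1\<close> of the solution itself.\<close>
  have q': "q - 1 = q * (p - 1)" using q by (simp add: algebra_simps)
  have "((\<lambda>s. b s powr q) has_real_derivative lam * (b t powr q) powr (p - 1)) (at t)"
  proof (rule DERIV_cong[OF DERIV_fun_powr])
    show "(b has_real_derivative (2 - p) * lam) (at t)"
      unfolding b_def by (rule derivative_eq_intros refl | simp)+
    have "q * b t powr (q - real 1) * ((2 - p) * lam) = (q * (2 - p)) * lam * b t powr (q - 1)"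
      by simp
    then show "q * b t powr (q - real 1) * ((2 - p) * lam) = lam * (b t powr q) powr (p - 1)"
      unfolding q by (simp add: q' powr_powr)
  qed (rule bt)
  then have "(decay p lam has_real_derivative lam * (b t powr q) powr (p - 1)) (at t)"
    by (rule DERIV_cong_ev[THEN iffD1, rotated -1])
       (use ev in \<open>auto simp: decay_def b_def q_def elim!: eventually_mono\<close>)
  then show ?thesis using True
    by (auto simp: decay_def b_def q_def intro: has_field_derivative_at_within)
next
  case False
  have "decay p lam s = 0" if "s \<ge> t" for s
  proof -
    have "(2 - p) * lam * s \<le> (2 - p) * lam * t"
      using that p lam by (intro mult_left_mono_neg) (auto intro: mult_nonneg_nonpos)
    with False show ?thesis by (simp add: decay_def)
  qed
  then have "(decay p lam has_real_derivative 0) (at t within {t..})"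
    by (intro has_field_derivative_transform_within[OF DERIV_const, of 1]) auto
  then have "(decay p lam has_real_derivative 0) (at_right t)"
    by (rule DERIV_subset) auto
  with False show ?thesis by auto
qed

text \<open>The scalar factor satisfies \<open>a' = lam * a powr (p - 1)\<close> while positive, and
  homogeneity scales the eigenvalue relation by that same power. After extinction the trajectory
  rests at the origin.\<close>

lemma eigenfunction_flow_solution:
  assumes p: "1 \<le> p" "p < 2"
    and setting: "gradient_flow_setting M p R P"
    and f: "f \<in> carrier_vec M" "f \<noteq> 0\<^sub>v M"
    and eig: "lam \<cdot>\<^sub>v f \<in> P f"
  shows "flow_solution M P f (\<lambda>t. decay p lam t \<cdot>\<^sub>v f)"
proof -
  from setting have R: "\<And>x. x \<in> carrier_vec M \<Longrightarrow> 0 \<le> R x"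
    and Rhom: "\<And>c x. x \<in> carrier_vec M \<Longrightarrow> R (c \<cdot>\<^sub>v x) = \<bar>c\<bar> powr p * R x"
    and P: "\<And>x. x \<in> carrier_vec M \<Longrightarrow> P x = uminus ` subdifferential M R x"
    and Phom: "\<And>c x. c \<noteq> 0 \<Longrightarrow> x \<in> carrier_vec M \<Longrightarrow>
        P (c \<cdot>\<^sub>v x) = (\<lambda>u. (c * \<bar>c\<bar> powr (p - 2)) \<cdot>\<^sub>v u) ` P x"
    unfolding gradient_flow_setting_def abs_homogeneous_def homogeneous_op_def by blast+
  have f0: "0 \<cdot>\<^sub>v f = 0\<^sub>v M" using f by (intro eq_vecI) auto
  have R0: "R (0\<^sub>v M) = 0" using Rhom[OF f(1), of 0] f0 by simp
  \<comment> \<open>\<open>homogeneous_op\<close> is silent about \<open>c = 0\<close>, so the value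
    at the origin comes from the subdifferential: \<open>R\<close> attains its minimum 0
    there.\<close>
  then have P0: "0\<^sub>v M \<in> P (0\<^sub>v M)"
    using R by (auto simp: P subdifferential_def intro!: image_eqI[of _ _ "0\<^sub>v M"])
  have lam: "lam \<le> 0"
  \<comment> \<open>The subgradient inequality at \<open>f\<close>, tested at the origin, reads
    \<open>R f + lam * (f \<bullet> f) \<le> 0\<close>.\<close>
  proof -
    from eig obtain g where g: "g \<in> carrier_vec M" "lam \<cdot>\<^sub>v f = - g"
      and sub: "R f + g \<bullet> (0\<^sub>v M - f) \<le> R (0\<^sub>v M)"
      by (auto simp: P[OF f(1)] subdifferential_def)
    have "g = - (lam \<cdot>\<^sub>v f)" using g by simp
    then have "g \<bullet> (0\<^sub>v M - f) = lam * (f \<bullet> f)" using f by simp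
    with sub R0 R[OF f(1)] have "lam * (f \<bullet> f) \<le> 0" by linarith
    with scalar_prod_self_pos[OF f] show ?thesis by (simp add: mult_le_0_iff)
  qed
  \<comment> \<open>Where the base is zero, continuity of the power relies on the exponent
    \<open>1 / (2 - p)\<close> being positive.\<close>
  have "continuous_on {0..} (decay p lam)"
    unfolding decay_def using p by (intro continuous_on_powr' continuous_intros) auto
  moreover have "\<exists>v\<in>P (decay p lam t \<cdot>\<^sub>v f). \<forall>i<M.
      ((\<lambda>s. (decay p lam s \<cdot>\<^sub>v f) $ i) has_real_derivative v $ i) (at_right t)" if t: "t \<ge> 0" for t
  proof -
    define d where "d = (if 1 + (2 - p) * lam * t > 0 then lam * decay p lam t powr (p - 1) else 0)"
    have "(decay p lam has_real_derivative d) (at_right t)"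
      unfolding d_def by (rule decay_has_right_derivative[OF p(2) lam t])
    then have "((\<lambda>s. decay p lam s * f $ i) has_real_derivative d * f $ i) (at_right t)" for i
      by (rule DERIV_cmult_right)
    moreover have "d \<cdot>\<^sub>v f \<in> P (decay p lam t \<cdot>\<^sub>v f)"
    proof (cases "1 + (2 - p) * lam * t > 0")
      case True
      then have pos: "decay p lam t > 0" by (simp add: decay_def)
      then have "decay p lam t * \<bar>decay p lam t\<bar> powr (p - 2) = decay p lam t powr (p - 1)"
        by (simp add: powr_mult_base)
      with Phom[of "decay p lam t" f] pos f True eig show ?thesis
        by (auto simp: d_def smult_smult_assoc mult.commute image_iff intro!: bexI[of _ "lam \<cdot>\<^sub>v f"])
    next
      case False
      moreover from False have "decay p lam t = 0" by (simp add: decay_def)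
      ultimately show ?thesis using P0 f0 by (simp add: d_def)
    qed
    ultimately show ?thesis using f by (intro bexI[of _ "d \<cdot>\<^sub>v f"]) auto
  qed
  moreover have "decay p lam 0 \<cdot>\<^sub>v f = f" using p by (simp add: decay_def)
  ultimately show ?thesis
    using f by (auto simp: flow_solution_def intro!: continuous_intros)
qed

section \<open>Singular value decomposition of a matrix of rank one\<close>

text \<open>The argument covers every admissible decomposition, so no uniqueness of singular vectors
  enters: the columns of \<open>U\<close> after the first may be any orthonormal completion.\<close>

lemma svd_rank_one:
  fixes f g :: "real vec"
  assumes svd: "is_svd (mat m n (\<lambda>(i, j). f $ i * g $ j)) U S V"
    and f: "f \<in> carrier_vec m" "f \<noteq> 0\<^sub>v m"
    and g: "g \<in> carrier_vec n" "g \<noteq> 0\<^sub>v n"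
  shows "\<And>i. 0 < i \<Longrightarrow> i < m \<Longrightarrow> col U i \<bullet> f = 0"
    and "f = (col U 0 \<bullet> f) \<cdot>\<^sub>v col U 0"
    and "(col U 0 \<bullet> f)\<^sup>2 = f \<bullet> f"
proof -
  define A where "A = mat m n (\<lambda>(i, j). f $ i * g $ j)"
  define u where "u = (\<lambda>i. col U i \<bullet> f)"
  from svd have U: "U \<in> carrier_mat m m" "U\<^sup>T * U = 1\<^sub>m m"
    and V: "V \<in> carrier_mat n n" "V\<^sup>T * V = 1\<^sub>m n"
    and S: "S \<in> carrier_mat m n" "diagonal_mat S"
    and nonneg: "\<And>i. i < min m n \<Longrightarrow> 0 \<le> S $$ (i, i)"
    and decr: "\<And>i j. i \<le> j \<Longrightarrow> j < min m n \<Longrightarrow> S $$ (j, j) \<le> S $$ (i, i)"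
    and A: "A = U * S * V\<^sup>T"
    by (auto simp: is_svd_def A_def)
  have Ac: "A \<in> carrier_mat m n" by (simp add: A_def)
  have m: "0 < m" using f by (cases m) (auto intro!: eq_vecI)
  have gg: "0 < g \<bullet> g" by (rule scalar_prod_self_pos[OF g])
  have UA: "(U\<^sup>T * A) = mat m n (\<lambda>(i, j). u i * g $ j)"
  proof (rule eq_matI)
    fix i j assume "i < dim_row (mat m n (\<lambda>(i, j). u i * g $ j))"
      "j < dim_col (mat m n (\<lambda>(i, j). u i * g $ j))"
    then have ij: "i < m" "j < n" by auto
    have "col A j = g $ j \<cdot>\<^sub>v f" using f ij by (intro eq_vecI) (auto simp: A_def)
    then show "(U\<^sup>T * A) $$ (i, j) = mat m n (\<lambda>(i, j). u i * g $ j) $$ (i, j)"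
      using U Ac f ij by (simp add: u_def)
  qed (use U in \<open>auto simp: A_def\<close>)
  have "U\<^sup>T * A = (U\<^sup>T * U) * S * V\<^sup>T"
    using U(1) S(1) V(1) by (simp add: A assoc_mult_mat[of _ m m _ m] assoc_mult_mat[of _ m m _ n])
  then have UASV: "U\<^sup>T * A = S * V\<^sup>T" using U(2) S(1) by simp
  \<comment> \<open>Passing to the Gram matrix of the rows eliminates \<open>V\<close> and leaves
    the diagonal matrix \<open>S * S\<^sup>T\<close>.\<close>
  have "(U\<^sup>T * A) * (U\<^sup>T * A)\<^sup>T = S * V\<^sup>T * (V * S\<^sup>T)"
    unfolding UASV using S V by (simp add: transpose_mult[of _ m n _ n])
  also have "\<dots> = S * (V\<^sup>T * V) * S\<^sup>T"
    using S(1) V(1) by (simp add: assoc_mult_mat[of _ m n _ n _ n] assoc_mult_mat[of _ m n _ n _ m] assoc_mult_mat[of _ n n _ n _ m])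
  also have "\<dots> = S * S\<^sup>T" using S V by simp
  finally have gram: "(U\<^sup>T * A) * (U\<^sup>T * A)\<^sup>T = S * S\<^sup>T" .
  \<comment> \<open>The case \<open>i < n\<close> matters when \<open>m > n\<close>: the rows of
    \<open>S\<close> from \<open>n\<close> on have no diagonal entry and vanish.\<close>
  have uu: "u i * u k * (g \<bullet> g) = (if i = k \<and> i < n then (S $$ (i, i))\<^sup>2 else 0)"
    if "i < m" "k < m" for i k
  proof -
    have "u i * u k * (g \<bullet> g) = ((U\<^sup>T * A) * (U\<^sup>T * A)\<^sup>T) $$ (i, k)"
      unfolding UA using that g by (simp add: scalar_prod_def sum_distrib_left algebra_simps)
    also have "\<dots> = (\<Sum>j<n. S $$ (i, j) * S $$ (k, j))"
      unfolding gram using that S(1) by (simp add: scalar_prod_def lessThan_atLeast0)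
    also have "\<dots> = (\<Sum>j<n. if j = i then (if i = k then (S $$ (i, i))\<^sup>2 else 0) else 0)"
      using that S by (intro sum.cong refl) (auto simp: diagonal_mat_def power2_eq_square)
    finally show ?thesis by auto
  qed
  have u0: "u i = 0" if i: "0 < i" "i < m" for i
  \<comment> \<open>A nonzero \<open>u i\<close> makes the singular value at \<open>i\<close>
    positive, hence by the ordering the one at 0, hence \<open>u 0\<close> nonzero; the off-diagonal
    Gram entry at \<open>(0, i)\<close> would then not vanish.\<close>
  proof (rule ccontr)
    assume "u i \<noteq> 0"
    with gg have "u i * u i * (g \<bullet> g) \<noteq> 0" by simp
    with uu[OF i(2) i(2)] have "i < n" "S $$ (i, i) \<noteq> 0" by (auto split: if_splits)
    with nonneg[of i] decr[of 0 i] i have "S $$ (0, 0) > 0" by auto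
    with uu[OF m m] \<open>i < n\<close> i have "u 0 \<noteq> 0" by auto
    with uu[of 0 i] i m gg \<open>u i \<noteq> 0\<close> show False by auto
  qed
  then show "\<And>i. 0 < i \<Longrightarrow> i < m \<Longrightarrow> col U i \<bullet> f = 0" by (simp add: u_def)
  \<comment> \<open>A left inverse of a square matrix is also a right inverse, so \<open>f\<close>
    expands in the columns of \<open>U\<close>; only the coefficient of the first survives.\<close>
  have "U * U\<^sup>T = 1\<^sub>m m"
    using mat_mult_left_right_inverse[of "U\<^sup>T" m U] U by simp
  then have "f = U *\<^sub>v (U\<^sup>T *\<^sub>v f)"
    using U f by (simp flip: assoc_mult_mat_vec[of _ m m _ m])
  also have "\<dots> = u 0 \<cdot>\<^sub>v col U 0"
  proof (rule eq_vecI)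
    fix i assume "i < dim_vec (u 0 \<cdot>\<^sub>v col U 0)"
    then have i: "i < m" using U by simp
    have "(U *\<^sub>v (U\<^sup>T *\<^sub>v f)) $ i = (\<Sum>k<m. U $$ (i, k) * u k)"
      using i U f by (simp add: scalar_prod_def u_def lessThan_atLeast0)
    also have "\<dots> = (\<Sum>k<m. if k = 0 then U $$ (i, 0) * u 0 else 0)"
      using u0 by (intro sum.cong) auto
    finally show "(U *\<^sub>v (U\<^sup>T *\<^sub>v f)) $ i = (u 0 \<cdot>\<^sub>v col U 0) $ i"
      using i U m by simp
  qed (use U in auto)
  finally show f0: "f = (col U 0 \<bullet> f) \<cdot>\<^sub>v col U 0" by (simp add: u_def)
  have "f \<bullet> f = (u 0 \<cdot>\<^sub>v col U 0) \<bullet> f" using f0 by (simp add: u_def)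
  also have "\<dots> = u 0 * u 0" using U m f by (simp add: u_def)
  finally show "(col U 0 \<bullet> f)\<^sup>2 = f \<bullet> f" by (simp add: u_def power2_eq_square)
qed

section \<open>DMD with a single mode\<close>

lemma seq_vec_carrier: "seq_vec a k m \<in> carrier_vec (Suc m - k)"
  unfolding seq_vec_def by (intro carrier_vecI) (simp only: dim_vec_of_list length_map length_upt)

lemma seq_vec_index: "j < Suc m - k \<Longrightarrow> seq_vec a k m $ j = a (k + j)"
  by (simp add: seq_vec_def vec_of_list_index del: upt_Suc vec_of_list_map)

lemma dmd_project_rank_one:
  assumes "U \<in> carrier_mat M M" "r \<le> M" "f \<in> carrier_vec M"
  shows "dmd_project r U (mat M n (\<lambda>(i, j). f $ i * g $ j)) =
    mat r n (\<lambda>(i, j). (col U i \<bullet> f) * g $ j)"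
  using assms
  by (intro eq_matI)
     (auto simp: dmd_project_def first_cols_def scalar_prod_def sum_distrib_right mult.assoc
       intro!: sum.cong)

text \<open>A zero row of \<open>X\<close> persists in \<open>X * X\<^sup>T * B\<close> for every
  \<open>B\<close>, while each row of the identity has a 1. This excludes several modes for rank-one
  data.\<close>

lemma not_dmd_exists_zero_row:
  assumes X: "X \<in> carrier_mat r n" and i: "i < r" and zero: "\<And>j. j < n \<Longrightarrow> X $$ (i, j) = 0"
  shows "\<not> dmd_exists X"
proof
  assume "dmd_exists X"
  then obtain B where B: "X * X\<^sup>T * B = 1\<^sub>m r" "B * (X * X\<^sup>T) = 1\<^sub>m (dim_row B)"
    using X by (auto simp: dmd_exists_def invertible_mat_def inverts_mat_def)
  \<comment> \<open>Invertibility does not state the size of the inverse; it is read off from the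
    two products.\<close>
  have dims: "dim_col B = r" "dim_row B = r"
    using arg_cong[OF B(1), of dim_col] arg_cong[OF B(2), of dim_col] X by auto
  have "(X * X\<^sup>T * B) $$ (i, i) = 0"
    using X i dims zero by (simp add: scalar_prod_def)
  with B(1) i show False by simp
qed

text \<open>With one row, \<open>F\<close> is a single number and the problem is scalar least
  squares. The common factor \<open>s\<close> cancels in the minimizer but remains squared in the
  residual.\<close>

lemma dmd_rank_one:
  fixes g h :: "real vec"
  assumes g: "g \<in> carrier_vec n" "g \<noteq> 0\<^sub>v n" and h: "h \<in> carrier_vec n" and s: "s \<noteq> 0"
  defines "X \<equiv> mat 1 n (\<lambda>(i, j). s * g $ j)" and "Y \<equiv> mat 1 n (\<lambda>(i, j). s * h $ j)"
  shows "dmd_exists X"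
    and "dmd_matrix X Y = mat 1 1 (\<lambda>_. (h \<bullet> g) / (g \<bullet> g))"
    and "is_arg_min (\<lambda>F. frobenius_sq (Y - F * X)) (\<lambda>F. F \<in> carrier_mat 1 1) (dmd_matrix X Y)"
    and "dmd_err X Y = s\<^sup>2 * (h \<bullet> h - (h \<bullet> g)\<^sup>2 / (g \<bullet> g))"
proof -
  have gg: "0 < g \<bullet> g" by (rule scalar_prod_self_pos[OF g])
  have XX: "X * X\<^sup>T = mat 1 1 (\<lambda>_. s\<^sup>2 * (g \<bullet> g))"
    using g by (intro eq_matI)
      (auto simp: X_def scalar_prod_def sum_distrib_left power2_eq_square algebra_simps)
  have YX: "Y * X\<^sup>T = mat 1 1 (\<lambda>_. s\<^sup>2 * (h \<bullet> g))"
    using g h by (intro eq_matI)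
      (auto simp: X_def Y_def scalar_prod_def sum_distrib_left power2_eq_square algebra_simps)
  define C where "C = mat 1 1 (\<lambda>_. 1 / (s\<^sup>2 * (g \<bullet> g)))"
  have XXC: "X * X\<^sup>T * C = 1\<^sub>m 1" "C * (X * X\<^sup>T) = 1\<^sub>m 1"
    unfolding XX C_def using gg s by (auto intro!: eq_matI simp: scalar_prod_def)
  show ex: "dmd_exists X"
    unfolding dmd_exists_def invertible_mat_def inverts_mat_def
    using XXC by (intro conjI exI[of _ C]) (auto simp: X_def C_def)
  have carXX: "X * X\<^sup>T \<in> carrier_mat 1 1" "C \<in> carrier_mat 1 1" by (simp_all add: XX C_def)
  \<comment> \<open>\<open>mat_inverse\<close> returns an option. Being a unit of the matrix ring
    rules out \<open>None\<close>, and uniqueness of inverses identifies the result with the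
    explicit reciprocal \<open>C\<close>.\<close>
  have "X * X\<^sup>T \<in> Units (ring_mat TYPE(real) 1 ())"
    using XXC carXX unfolding Units_def by (auto simp: ring_mat_def)
  then obtain B where B: "mat_inverse (X * X\<^sup>T) = Some B"
    using mat_inverse(1)[OF carXX(1), where b = "()"] by (cases "mat_inverse (X * X\<^sup>T)") auto
  from mat_inverse(2)[OF carXX(1) B] have BX: "B * (X * X\<^sup>T) = 1\<^sub>m 1" "B \<in> carrier_mat 1 1"
    by auto
  have "B = B * (X * X\<^sup>T * C)" using XXC BX by simp
  also have "\<dots> = B * (X * X\<^sup>T) * C"
    by (rule assoc_mult_mat[symmetric]) (use BX carXX in auto)
  also have "\<dots> = C" using BX carXX by simp
  finally have "B = C" .
  then show F: "dmd_matrix X Y = mat 1 1 (\<lambda>_. (h \<bullet> g) / (g \<bullet> g))"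
    unfolding dmd_matrix_def B YX C_def using s gg
    by (auto intro!: eq_matI simp: scalar_prod_def)
  define e where "e = s\<^sup>2 * (h \<bullet> h - (h \<bullet> g)\<^sup>2 / (g \<bullet> g))"
  \<comment> \<open>Completing the square: the minimal value \<open>e\<close> plus a nonnegative
    term that is zero exactly at the claimed minimizer.\<close>
  have err: "frobenius_sq (Y - F * X) =
      e + s\<^sup>2 * (g \<bullet> g) * (F $$ (0, 0) - (h \<bullet> g) / (g \<bullet> g))\<^sup>2"
    if "F \<in> carrier_mat 1 1" for F
  proof -
    let ?c = "F $$ (0, 0)"
    have "frobenius_sq (Y - F * X) = (\<Sum>j<n. (s * h $ j - ?c * (s * g $ j))\<^sup>2)"
      using that by (auto simp: frobenius_sq_def X_def Y_def scalar_prod_def intro!: sum.cong)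
    also have "\<dots> = (\<Sum>j<n. s\<^sup>2 * (h $ j * h $ j) - 2 * ?c * s\<^sup>2 * (h $ j * g $ j)
        + ?c\<^sup>2 * s\<^sup>2 * (g $ j * g $ j))"
      by (intro sum.cong refl) (simp add: power2_eq_square algebra_simps)
    also have "\<dots> = s\<^sup>2 * (h \<bullet> h) - 2 * ?c * s\<^sup>2 * (h \<bullet> g) + ?c\<^sup>2 * s\<^sup>2 * (g \<bullet> g)"
      using g h by (simp add: scalar_prod_lessThan[of _ n] sum.distrib sum_subtractf sum_distrib_left)
    also have "\<dots> = e + s\<^sup>2 * (g \<bullet> g) * (?c - (h \<bullet> g) / (g \<bullet> g))\<^sup>2"
    proof -
      \<comment> \<open>Writing \<open>h \<bullet> g\<close> as \<open>q * (g \<bullet> g)\<close>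
        removes the divisions, leaving a polynomial identity.\<close>
      define q where "q = (h \<bullet> g) / (g \<bullet> g)"
      have hg: "h \<bullet> g = q * (g \<bullet> g)" using gg by (simp add: q_def)
      have "e = s\<^sup>2 * (h \<bullet> h) - s\<^sup>2 * (q * q * (g \<bullet> g))"
        unfolding e_def hg using gg by (simp add: power2_eq_square algebra_simps)
      then show ?thesis
        unfolding q_def[symmetric] hg using gg by (simp add: power2_eq_square algebra_simps)
    qed
    finally show ?thesis .
  qed
  have Fc: "dmd_matrix X Y \<in> carrier_mat 1 1" by (simp add: F)
  have min: "frobenius_sq (Y - dmd_matrix X Y * X) = e"
    using err[OF Fc] by (simp add: F)
  have le: "e \<le> frobenius_sq (Y - F * X)" if "F \<in> carrier_mat 1 1" for F
    unfolding err[OF that] using gg by simp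
  show "is_arg_min (\<lambda>F. frobenius_sq (Y - F * X)) (\<lambda>F. F \<in> carrier_mat 1 1) (dmd_matrix X Y)"
    using le Fc by (auto simp: is_arg_min_linorder min)
  show "dmd_err X Y = s\<^sup>2 * (h \<bullet> h - (h \<bullet> g)\<^sup>2 / (g \<bullet> g))"
    unfolding dmd_err_def e_def[symmetric]
  proof (rule cInf_eq_minimum)
    show "e \<in> (\<lambda>F. frobenius_sq (Y - F * X)) ` carrier_mat (dim_row X) (dim_row X)"
      using Fc min by (intro image_eqI[of _ _ "dmd_matrix X Y"]) (auto simp: X_def)
  qed (use le in \<open>auto simp: X_def\<close>)
qed

text \<open>A 1 by 1 matrix multiplies every vector by its entry, and normalization leaves only a
  complex phase free.\<close>

lemma dmd_eigenpair_1x1_iff: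
  "dmd_eigenpair (mat 1 1 (\<lambda>_. m)) \<mu> w \<longleftrightarrow>
    \<mu> = complex_of_real m \<and> (\<exists>c. cmod c = 1 \<and> w = vec 1 (\<lambda>_. c))"
proof (cases "w \<in> carrier_vec 1")
  case True
  then have w: "w = vec 1 (\<lambda>_. w $ 0)" by (intro eq_vecI) auto
  have "w \<bullet>c w = complex_of_real ((cmod (w $ 0))\<^sup>2)"
    by (subst (1 2) w) (simp add: scalar_prod_def complex_norm_square del: of_real_power)
  then have norm: "w \<bullet>c w = 1 \<longleftrightarrow> cmod (w $ 0) = 1"
    by (simp only: of_real_eq_1_iff abs_square_eq_1 abs_norm_cancel)
  have "map_mat complex_of_real (mat 1 1 (\<lambda>_. m)) *\<^sub>v w = \<mu> \<cdot>\<^sub>v w \<longleftrightarrow> m * w $ 0 = \<mu> * w $ 0"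
    using True by (auto simp: scalar_prod_def vec_eq_iff)
  moreover have "w = 0\<^sub>v 1 \<longleftrightarrow> w $ 0 = 0" using True by (auto simp: vec_eq_iff)
  moreover have "(\<exists>c. cmod c = 1 \<and> w = vec 1 (\<lambda>_. c)) \<longleftrightarrow> cmod (w $ 0) = 1"
    using w by (metis index_vec less_one)
  ultimately show ?thesis
    using True norm by (auto simp: dmd_eigenpair_def eigenvector_def)
qed (auto simp: dmd_eigenpair_def eigenvector_def)

lemma dmd_mode_single:
  assumes "U \<in> carrier_mat M M" "0 < M"
  shows "dmd_mode 1 U (vec 1 (\<lambda>_. c)) = c \<cdot>\<^sub>v map_vec complex_of_real (col U 0)"
  using assms by (intro eq_vecI) (auto simp: dmd_mode_def first_cols_def scalar_prod_def)

lemma dmd_coord_single: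
  assumes "U \<in> carrier_mat M M" "0 < M" "x \<in> carrier_vec M"
  shows "dmd_coord 1 U x (vec 1 (\<lambda>_. c)) = cnj c * complex_of_real (col U 0 \<bullet> x)"
  using assms by (auto simp: dmd_coord_def first_cols_def scalar_prod_def)

text \<open>Normalized eigenvectors are fixed only up to a phase \<open>c\<close>: one choice gives
  the stated mode and coordinate exactly, every other rotates them by \<open>c\<close> and
  \<open>cnj c\<close>. The projected data have size proportional to the norm of \<open>f\<close>,
  hence the factor \<open>(vnorm f)\<^sup>2\<close> in the error, which is 1 for a unit
  \<open>f\<close>. The bound \<open>r \<le> M\<close> reflects that \<open>U\<close> has
  \<open>M\<close> columns.\<close>

theorem lemma1:
  fixes M N :: nat and p lam dt :: real
    and R :: "real vec \<Rightarrow> real" and P :: "real vec \<Rightarrow> real vec set"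
    and f :: "real vec" and \<psi> :: "real \<Rightarrow> real vec"
    and U S V :: "real mat"
  assumes p: "1 \<le> p" "p < 2"
    and setting: "gradient_flow_setting M p R P"
    and f: "f \<in> carrier_vec M" "f \<noteq> 0\<^sub>v M"
    and eigenfunction: "lam \<cdot>\<^sub>v f \<in> P f"
    and flow: "flow_solution M P f \<psi>"
    and dt: "dt > 0"
    and N: "N \<ge> 1"
  defines "\<psi>s \<equiv> \<lambda>k::nat. \<psi> (real k * dt)"
    and "a \<equiv> \<lambda>k::nat. decay p lam (real k * dt)"
  defines "\<Psi>0 \<equiv> snapshot_mat M \<psi>s 0 (N - 1)"
    and "\<Psi>1 \<equiv> snapshot_mat M \<psi>s 1 N"
    and "a0 \<equiv> seq_vec a 0 (N - 1)"
    and "a1 \<equiv> seq_vec a 1 N"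
  assumes svd: "is_svd \<Psi>0 U S V"
  defines "X \<equiv> dmd_project 1 U \<Psi>0"
    and "Y \<equiv> dmd_project 1 U \<Psi>1"
  shows "dmd_exists X \<and>
    is_arg_min (\<lambda>F. frobenius_sq (Y - F * X)) (\<lambda>F. F \<in> carrier_mat 1 1) (dmd_matrix X Y) \<and>
    (\<exists>w. dmd_eigenpair (dmd_matrix X Y) (complex_of_real ((a1 \<bullet> a0) / (vnorm a0)\<^sup>2)) w \<and>
         dmd_mode 1 U w = map_vec complex_of_real ((1 / vnorm f) \<cdot>\<^sub>v f) \<and>
         dmd_coord 1 U (\<psi>s 0) w = complex_of_real (vnorm f)) \<and>
    (\<forall>\<mu> w. dmd_eigenpair (dmd_matrix X Y) \<mu> w \<longrightarrow>
         \<mu> = complex_of_real ((a1 \<bullet> a0) / (vnorm a0)\<^sup>2) \<and>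
         (\<exists>c. cmod c = 1 \<and>
              dmd_mode 1 U w = c \<cdot>\<^sub>v map_vec complex_of_real ((1 / vnorm f) \<cdot>\<^sub>v f) \<and>
              dmd_coord 1 U (\<psi>s 0) w = cnj c * complex_of_real (vnorm f))) \<and>
    dmd_err X Y = (vnorm f)\<^sup>2 * ((vnorm a1)\<^sup>2 - (a1 \<bullet> a0)\<^sup>2 / (vnorm a0)\<^sup>2) \<and>
    (\<forall>r. 1 < r \<and> r \<le> M \<longrightarrow> \<not> dmd_exists (dmd_project r U \<Psi>0))"
proof -
  have M: "0 < M" using f by (cases M) (auto intro!: eq_vecI)
  have mono: "monotone_op M (\<lambda>x. uminus ` P x)"
    using setting by (simp add: gradient_flow_setting_def maximal_monotone_op_def)
  have \<psi>s: "\<psi>s k = a k \<cdot>\<^sub>v f" for k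
    unfolding \<psi>s_def a_def
    using flow_solution_unique[OF mono flow eigenfunction_flow_solution[OF p setting f eigenfunction]] dt
    by simp
  have a_0: "a 0 = 1" by (simp add: a_def decay_def)
  \<comment> \<open>Since \<open>N \<ge> 1\<close>, the truncated difference \<open>N - 1\<close> is
    exact, and both vectors have \<open>N\<close> entries, shifted by one.\<close>
  have a0: "a0 \<in> carrier_vec N" "\<And>j. j < N \<Longrightarrow> a0 $ j = a j"
    and a1: "a1 \<in> carrier_vec N" "\<And>j. j < N \<Longrightarrow> a1 $ j = a (Suc j)"
    using N seq_vec_carrier[of a 0 "N - 1"] seq_vec_carrier[of a 1 N]
    by (simp_all add: a0_def a1_def seq_vec_index)
  \<comment> \<open>The initial sample equals 1, so this holds even if the flow is extinct from the
    first step on.\<close>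
  have a0_nz: "a0 \<noteq> 0\<^sub>v N"
    using a0(2)[of 0] a_0 N by (auto simp del: a0(2))
  have \<Psi>0: "\<Psi>0 = mat M N (\<lambda>(i, j). f $ i * a0 $ j)"
    using N f a0 by (intro eq_matI)
      (auto simp: \<Psi>0_def snapshot_mat_def mat_of_cols_index \<psi>s simp del: upt_Suc)
  have \<Psi>1: "\<Psi>1 = mat M N (\<lambda>(i, j). f $ i * a1 $ j)"
    using N f a1 by (intro eq_matI)
      (auto simp: \<Psi>1_def snapshot_mat_def mat_of_cols_index \<psi>s simp del: upt_Suc)
  have U: "U \<in> carrier_mat M M" using svd by (simp add: is_svd_def \<Psi>0)
  note svd1 = svd_rank_one[OF svd[unfolded \<Psi>0] f a0(1) a0_nz]
  \<comment> \<open>This equals the norm of \<open>f\<close> up to the sign that the decomposition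
    leaves open.\<close>
  define s where "s = col U 0 \<bullet> f"
  have ff: "0 < f \<bullet> f" by (rule scalar_prod_self_pos[OF f])
  have s2: "s\<^sup>2 = (vnorm f)\<^sup>2" using svd1(3) by (simp add: s_def vnorm_power2)
  have nf: "vnorm f > 0" using ff by (simp add: vnorm_def)
  with s2 have s: "s \<noteq> 0" by auto
  have abs_s: "\<bar>s\<bar> = vnorm f" using s2 nf by (auto simp: power2_eq_iff)
  have X: "X = mat 1 N (\<lambda>(i, j). s * a0 $ j)" and Y: "Y = mat 1 N (\<lambda>(i, j). s * a1 $ j)"
    unfolding X_def Y_def \<Psi>0 \<Psi>1 using U M f
    by (auto simp: dmd_project_rank_one[of _ M] s_def intro!: eq_matI)
  note dmd = dmd_rank_one[OF a0(1) a0_nz a1(1) s, folded X Y]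
  have f_col: "f = s \<cdot>\<^sub>v col U 0" using svd1(2) by (simp add: s_def)
  have col: "col U 0 = sgn s \<cdot>\<^sub>v ((1 / vnorm f) \<cdot>\<^sub>v f)"
  proof -
    have "(1 / vnorm f) \<cdot>\<^sub>v f = (1 / vnorm f) \<cdot>\<^sub>v (s \<cdot>\<^sub>v col U 0)"
      by (rule arg_cong[OF f_col])
    then have "sgn s \<cdot>\<^sub>v ((1 / vnorm f) \<cdot>\<^sub>v f) = (sgn s * (1 / vnorm f * s)) \<cdot>\<^sub>v col U 0"
      by (simp only: smult_smult_assoc)
    moreover have "sgn s * (1 / vnorm f * s) = \<bar>s\<bar> / vnorm f" by (simp add: abs_sgn)
    moreover have "\<bar>s\<bar> / vnorm f = 1" unfolding abs_s using nf by simp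
    ultimately show ?thesis by (simp only: scalar_vec_one)
  qed
  have mode: "dmd_mode 1 U (vec 1 (\<lambda>_. c)) =
      (c * sgn s) \<cdot>\<^sub>v map_vec complex_of_real ((1 / vnorm f) \<cdot>\<^sub>v f)" for c
    unfolding dmd_mode_single[OF U M] col by (intro eq_vecI) auto
  have \<psi>0: "\<psi>s 0 = f" using \<psi>s[of 0] a_0 by simp
  have coord: "dmd_coord 1 U (\<psi>s 0) (vec 1 (\<lambda>_. c)) = cnj (c * sgn s) * complex_of_real (vnorm f)" for c
    unfolding \<psi>0 dmd_coord_single[OF U M f(1)] s_def[symmetric]
    using sgn_mult_abs[of s] unfolding abs_s by (simp flip: of_real_mult)
  have sgn_norm: "cmod (complex_of_real (sgn s)) = 1" using s by (simp add: sgn_if)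
  have pair: "dmd_eigenpair (dmd_matrix X Y) \<mu> w \<longleftrightarrow>
      \<mu> = complex_of_real ((a1 \<bullet> a0) / (vnorm a0)\<^sup>2) \<and>
      (\<exists>c. cmod c = 1 \<and> w = vec 1 (\<lambda>_. c))" for \<mu> w
    unfolding dmd(2) dmd_eigenpair_1x1_iff vnorm_power2 ..
  have "\<exists>w. dmd_eigenpair (dmd_matrix X Y) (complex_of_real ((a1 \<bullet> a0) / (vnorm a0)\<^sup>2)) w \<and>
         dmd_mode 1 U w = map_vec complex_of_real ((1 / vnorm f) \<cdot>\<^sub>v f) \<and>
         dmd_coord 1 U (\<psi>s 0) w = complex_of_real (vnorm f)"
  proof (intro exI conjI)
    \<comment> \<open>The phase \<open>sgn s\<close> cancels the sign of the first column of
      \<open>U\<close>, in the mode and in the coordinate alike.\<close>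
    show "dmd_eigenpair (dmd_matrix X Y) (complex_of_real ((a1 \<bullet> a0) / (vnorm a0)\<^sup>2))
        (vec 1 (\<lambda>_. complex_of_real (sgn s)))"
      using pair sgn_norm by blast
  qed (simp_all only: mode coord flip: of_real_mult, simp_all add: s)
  moreover have "\<mu> = complex_of_real ((a1 \<bullet> a0) / (vnorm a0)\<^sup>2) \<and>
         (\<exists>c. cmod c = 1 \<and>
              dmd_mode 1 U w = c \<cdot>\<^sub>v map_vec complex_of_real ((1 / vnorm f) \<cdot>\<^sub>v f) \<and>
              dmd_coord 1 U (\<psi>s 0) w = cnj c * complex_of_real (vnorm f))"
    if ep: "dmd_eigenpair (dmd_matrix X Y) \<mu> w" for \<mu> w
  proof -
    from ep[unfolded pair] obtain c where c: "\<mu> = complex_of_real ((a1 \<bullet> a0) / (vnorm a0)\<^sup>2)"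
      "cmod c = 1" "w = vec 1 (\<lambda>_. c)" by blast
    have "cmod (c * sgn s) = 1" unfolding norm_mult using c(2) sgn_norm by simp
    with c mode coord show ?thesis by blast
  qed
  moreover have "\<not> dmd_exists (dmd_project r U \<Psi>0)" if r: "1 < r \<and> r \<le> M" for r
    unfolding \<Psi>0 dmd_project_rank_one[OF U conjunct2[OF r] f(1)]
    \<comment> \<open>Indices start at 0, so \<open>i = 1\<close> is the second row, present because
      \<open>r > 1\<close> and zero because the second column of \<open>U\<close> is orthogonal to
      \<open>f\<close>.\<close>
    by (rule not_dmd_exists_zero_row[where i = 1]) (use r svd1(1) in auto)
  moreover have "dmd_err X Y = (vnorm f)\<^sup>2 * ((vnorm a1)\<^sup>2 - (a1 \<bullet> a0)\<^sup>2 / (vnorm a0)\<^sup>2)"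
    unfolding dmd(4) s2 vnorm_power2 ..
  ultimately show ?thesis using dmd(1,3) by blast
qed

end
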